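(* If $G$ is a graph whose adjacency matrix belongs to a homogeneous partially coherent algebra, then $$\mu(G)=\vartheta(\overline{G}).$$
   Context: Graphs are finite and simple with nonempty vertex set $V$, $n=|V|$; $\overline{G}$ is the complement of $G$ and $A_G\in\mathbb{R}^{V\times V}$ the adjacency matrix. $I$ is the identity matrix, $J$ the all-ones matrix, $\circ$ the entrywise (Schur) product, $\langle A,B\rangle=\operatorname{trace}(AB)$ for real symmetric $A,B$, and $A\preceq B$ means $B-A$ is positive semidefinite. A partially coherent algebra with respect to $I$ and $A_G$ is a subalgebra $\mathcal{A}_G$ of $\mathbb{R}^{V\times V}$ that contains $I$, $J$ and $A_G$, is self-adjoint (closed under transposition), and is closed under Schur product with $I$ and with $A_G$ (i.e. $M\in\mathcal{A}_G$ implies $I\circ M, A_G\circ M\in\mathcal{A}_G$). It is homogeneous if every matrix in it has constant diagonal. "The adjacency matrix of $G$ belongs to a homogeneous partially coherent algebra" means that such an algebra with respect to $I$ and $A_G$ exists and is homogeneous. For real $k\in[1,n]$, $$\vartheta_k(G)=\max\{\langle J,X\rangle : X \text{ real symmetric } V\times V,\ \langle I,X\rangle=k,\ A_G\circ X=0,\ 0\preceq X\preceq I\},$$ and $\vartheta(G)=\vartheta_1(G)$ is the Lovász theta number. Define $\mu(G)=\min\{k\in[1,n] : \vartheta_k(G)=n\}$, where $k$ ranges over real numbers. *)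

theory Defs
  imports "HOL-Analysis.Analysis"
begin

(* The vertex set of a graph is the universe of the finite index type 'v, so
   n = CARD('v) >= 1, and V x V matrices have type real^'v^'v. *)

definition simple_graph :: "('v \<Rightarrow> 'v \<Rightarrow> bool) \<Rightarrow> bool" where
  "simple_graph E \<longleftrightarrow> symp E \<and> irreflp E"

definition complement_graph :: "('v \<Rightarrow> 'v \<Rightarrow> bool) \<Rightarrow> 'v \<Rightarrow> 'v \<Rightarrow> bool" where
  "complement_graph E x y \<longleftrightarrow> x \<noteq> y \<and> \<not> E x y"

definition adjacency_matrix :: "('v::finite \<Rightarrow> 'v \<Rightarrow> bool) \<Rightarrow> real^'v^'v" where
  "adjacency_matrix E = (\<chi> x y. if E x y then 1 else 0)"

definition all_ones :: "real^'v^'v::finite" where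
  "all_ones = (\<chi> x y. 1)"

definition schur_product :: "real^'v^'v \<Rightarrow> real^'v^'v \<Rightarrow> real^'v::finite^'v" where
  "schur_product A B = (\<chi> x y. A $ x $ y * B $ x $ y)"

definition trace_inner :: "real^'v^'v \<Rightarrow> real^'v::finite^'v \<Rightarrow> real" where
  "trace_inner A B = trace (A ** B)"

definition pos_semidef :: "real^'v::finite^'v \<Rightarrow> bool" where
  "pos_semidef M \<longleftrightarrow> transpose M = M \<and> (\<forall>v. 0 \<le> v \<bullet> (M *v v))"

definition loewner_le :: "real^'v::finite^'v \<Rightarrow> real^'v^'v \<Rightarrow> bool" where
  "loewner_le A B \<longleftrightarrow> pos_semidef (B - A)"

definition matrix_subalgebra :: "(real^'v::finite^'v) set \<Rightarrow> bool" where
  "matrix_subalgebra \<A> \<longleftrightarrow> subspace \<A> \<and> (\<forall>M\<in>\<A>. \<forall>N\<in>\<A>. M ** N \<in> \<A>)"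

definition partially_coherent_algebra ::
    "('v::finite \<Rightarrow> 'v \<Rightarrow> bool) \<Rightarrow> (real^'v^'v) set \<Rightarrow> bool" where
  "partially_coherent_algebra E \<A> \<longleftrightarrow>
     matrix_subalgebra \<A> \<and>
     mat 1 \<in> \<A> \<and> all_ones \<in> \<A> \<and> adjacency_matrix E \<in> \<A> \<and>
     (\<forall>M\<in>\<A>. transpose M \<in> \<A>) \<and>
     (\<forall>M\<in>\<A>. schur_product (mat 1) M \<in> \<A>) \<and>
     (\<forall>M\<in>\<A>. schur_product (adjacency_matrix E) M \<in> \<A>)"

definition homogeneous :: "(real^'v::finite^'v) set \<Rightarrow> bool" where
  "homogeneous \<A> \<longleftrightarrow> (\<forall>M\<in>\<A>. \<forall>x y. M $ x $ x = M $ y $ y)"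

definition theta_feasible ::
    "('v::finite \<Rightarrow> 'v \<Rightarrow> bool) \<Rightarrow> real \<Rightarrow> (real^'v^'v) set" where
  "theta_feasible E k =
     {X. transpose X = X \<and> trace_inner (mat 1) X = k \<and>
         schur_product (adjacency_matrix E) X = 0 \<and>
         loewner_le 0 X \<and> loewner_le X (mat 1)}"

(* GREATEST and LEAST denote an attained maximum and minimum; that both are attained
   is shown in theta_k_max and mu_min below. *)

definition theta_k :: "('v::finite \<Rightarrow> 'v \<Rightarrow> bool) \<Rightarrow> real \<Rightarrow> real" where
  "theta_k E k = (GREATEST t. t \<in> trace_inner all_ones ` theta_feasible E k)"

definition lovasz_theta :: "('v::finite \<Rightarrow> 'v \<Rightarrow> bool) \<Rightarrow> real" where
  "lovasz_theta E = theta_k E 1"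

definition mu :: "('v::finite \<Rightarrow> 'v \<Rightarrow> bool) \<Rightarrow> real" where
  "mu E = (LEAST k. k \<in> {1..real CARD('v)} \<and> theta_k E k = real CARD('v))"

lemma trace_inner_all_ones:
  "trace_inner all_ones X = (\<Sum>i\<in>UNIV. \<Sum>j\<in>UNIV. X $ i $ j)"
proof -
  have "trace_inner all_ones X = (\<Sum>i\<in>UNIV. \<Sum>j\<in>UNIV. X $ j $ i)"
    by (simp add: trace_inner_def trace_def matrix_matrix_mult_def all_ones_def)
  also have "\<dots> = (\<Sum>i\<in>UNIV. \<Sum>j\<in>UNIV. X $ i $ j)"
    by (rule sum.swap)
  finally show ?thesis .
qed

lemma trace_inner_mat_1: "trace_inner (mat 1) X = (\<Sum>i\<in>UNIV. X $ i $ i)"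
  by (simp add: trace_inner_def trace_def)

lemma quadratic_form:
  fixes X :: "real^'v::finite^'v"
  shows "v \<bullet> (X *v v) = (\<Sum>i\<in>UNIV. \<Sum>j\<in>UNIV. v $ i * X $ i $ j * v $ j)"
  by (simp add: inner_vec_def matrix_vector_mult_def sum_distrib_left mult.assoc)

lemma relaxed_feasible_bound:
  fixes X :: "real^'v::finite^'v"
  assumes "loewner_le 0 X" "loewner_le X (mat 1)"
  shows "\<bar>X $ i $ j\<bar> \<le> 1"
proof -
  have sym: "X $ j $ i = X $ i $ j"
    using assms(1) unfolding loewner_le_def pos_semidef_def transpose_def vec_eq_iff by simp
  have pos: "0 \<le> v \<bullet> (X *v v)" for v
    using assms(1) by (simp add: loewner_le_def pos_semidef_def)
  have le: "v \<bullet> (X *v v) \<le> v \<bullet> v" for v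
    using assms(2) by (simp add: loewner_le_def pos_semidef_def matrix_vector_mult_diff_rdistrib
        inner_diff_right)
  have ax: "axis a 1 \<bullet> (X *v axis b 1) = X $ a $ b" for a b
    by (simp add: inner_axis' matrix_vector_mult_basis column_def)
  have d: "X $ a $ a \<le> 1" for a
    using le[of "axis a 1"] by (simp add: ax inner_axis_axis)
  have "0 \<le> X $ i $ i + X $ j $ j + 2 * X $ i $ j"
    using pos[of "axis i 1 + axis j 1"]
    by (simp add: matrix_vector_right_distrib inner_add_left inner_add_right ax sym)
  moreover have "0 \<le> X $ i $ i + X $ j $ j - 2 * X $ i $ j"
    using pos[of "axis i 1 - axis j 1"]
    by (simp add: matrix_vector_mult_diff_distrib inner_diff_left inner_diff_right ax sym)
  ultimately show ?thesis using d[of i] d[of j] by linarith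
qed

lemma loewner_le_0: "loewner_le 0 X \<longleftrightarrow> pos_semidef X"
  by (simp add: loewner_le_def)

lemma loewner_le_mat_1:
  "loewner_le X (mat 1) \<longleftrightarrow> transpose X = X \<and> (\<forall>v. v \<bullet> (X *v v) \<le> v \<bullet> v)"
proof -
  have "transpose (mat 1 - X) = mat 1 - transpose X"
    by (simp add: transpose_def mat_def vec_eq_iff)
  then show ?thesis
    by (auto simp: loewner_le_def pos_semidef_def matrix_vector_mult_diff_rdistrib
        inner_diff_right)
qed

definition relaxed_feasible :: "('v::finite \<Rightarrow> 'v \<Rightarrow> bool) \<Rightarrow> (real^'v^'v) set" where
  "relaxed_feasible E =
     {X. schur_product (adjacency_matrix E) X = 0 \<and>
         loewner_le 0 X \<and> loewner_le X (mat 1)}"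

lemma theta_feasible_relaxed:
  "theta_feasible E k = relaxed_feasible E \<inter> {X. trace_inner (mat 1) X = k}"
  by (auto simp: theta_feasible_def relaxed_feasible_def loewner_le_def pos_semidef_def)

lemma compact_relaxed_feasible: "compact (relaxed_feasible E)"
proof -
  have eq: "relaxed_feasible E =
      (\<Inter>i j. {X. adjacency_matrix E $ i $ j * X $ i $ j = 0}) \<inter>
      (\<Inter>i j. {X. X $ j $ i = X $ i $ j}) \<inter>
      (\<Inter>v. {X. 0 \<le> v \<bullet> (X *v v)}) \<inter>
      (\<Inter>v. {X. v \<bullet> (X *v v) \<le> v \<bullet> v})"
    (is "_ = ?R")
  proof -
    have "X \<in> relaxed_feasible E \<longleftrightarrow> X \<in> ?R" for X
      unfolding relaxed_feasible_def schur_product_def loewner_le_0 loewner_le_mat_1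
        pos_semidef_def transpose_def vec_eq_iff
      by (simp only: mem_Collect_eq Int_iff INT_iff UNIV_I ball_UNIV vec_lambda_beta
          zero_index) blast
    then show ?thesis by blast
  qed
  have "closed (relaxed_feasible E)"
    unfolding eq quadratic_form
    by (intro closed_Int closed_INT ballI closed_Collect_eq closed_Collect_le continuous_intros)
  moreover have "bounded (relaxed_feasible E)"
  proof (rule boundedI)
    fix X assume X: "X \<in> relaxed_feasible E"
    have "norm X \<le> (\<Sum>i\<in>UNIV. norm (X $ i))"
      by (rule norm_le_l1_cart[of "\<chi> i. norm (X $ i)", simplified, THEN order_trans[rotated]])
         (simp add: norm_vec_def)
    also have "\<dots> \<le> (\<Sum>i\<in>(UNIV::'a set). \<Sum>j\<in>(UNIV::'a set). 1)"
      using X by (intro sum_mono order_trans[OF norm_le_l1_cart])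
        (auto simp: relaxed_feasible_def relaxed_feasible_bound)
    finally show "norm X \<le> (\<Sum>i\<in>(UNIV::'a set). \<Sum>j\<in>(UNIV::'a set). 1)" .
  qed
  ultimately show ?thesis by (simp add: compact_eq_bounded_closed)
qed

lemma continuous_on_trace_inner_all_ones: "continuous_on S (trace_inner all_ones)"
  unfolding trace_inner_all_ones[abs_def] by (intro continuous_intros)

lemma continuous_on_trace_inner_mat_1: "continuous_on S (trace_inner (mat 1))"
  unfolding trace_inner_mat_1[abs_def] by (intro continuous_intros)

lemma scaled_mat_1_feasible:
  fixes E :: "'v::finite \<Rightarrow> 'v \<Rightarrow> bool"
  assumes "simple_graph E" "0 \<le> c" "c \<le> 1"
  shows "c *\<^sub>R mat 1 \<in> theta_feasible E (c * real CARD('v))"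
proof -
  have quad: "v \<bullet> ((c *\<^sub>R (mat 1 :: real^'v^'v)) *v v) = c * (v \<bullet> v)" for v
    by (simp add: scaleR_matrix_vector_assoc[symmetric])
  have psd: "pos_semidef (d *\<^sub>R (mat 1 :: real^'v^'v))" if "0 \<le> d" for d
  proof -
    have "transpose (d *\<^sub>R (mat 1 :: real^'v^'v)) = d *\<^sub>R mat 1"
      by (simp add: transpose_def mat_def vec_eq_iff)
    with that show ?thesis
      by (simp add: pos_semidef_def scaleR_matrix_vector_assoc[symmetric])
  qed
  have "pos_semidef (mat 1 - c *\<^sub>R (mat 1 :: real^'v^'v))"
    using psd[of "1 - c"] assms(3) by (simp add: scaleR_left_diff_distrib)
  moreover have "schur_product (adjacency_matrix E) (c *\<^sub>R mat 1) = 0"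
    using assms(1) by (auto simp: simple_graph_def irreflp_def schur_product_def
        adjacency_matrix_def mat_def vec_eq_iff)
  moreover have "trace_inner (mat 1) (c *\<^sub>R (mat 1 :: real^'v^'v)) = c * real CARD('v)"
    unfolding trace_inner_mat_1 by (simp add: mat_def mult.commute)
  ultimately show ?thesis
    using psd[OF assms(2)]
    by (auto simp: theta_feasible_relaxed relaxed_feasible_def loewner_le_def)
qed

lemma theta_k_max:
  fixes E :: "'v::finite \<Rightarrow> 'v \<Rightarrow> bool"
  assumes "simple_graph E" "1 \<le> k" "k \<le> real CARD('v)"
  shows "theta_k E k \<in> trace_inner all_ones ` theta_feasible E k"
    and "\<And>X. X \<in> theta_feasible E k \<Longrightarrow> trace_inner all_ones X \<le> theta_k E k"
proof -
  have "closed {X :: real^'v^'v. trace_inner (mat 1) X = k}"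
    by (intro closed_Collect_eq continuous_on_trace_inner_mat_1 continuous_on_const)
  then have comp: "compact (theta_feasible E k)"
    unfolding theta_feasible_relaxed by (intro compact_Int_closed compact_relaxed_feasible)
  have "(k / real CARD('v)) *\<^sub>R mat 1 \<in> theta_feasible E k"
    using scaled_mat_1_feasible[OF assms(1), of "k / real CARD('v)"] assms(2,3) by simp
  then obtain X where X: "X \<in> theta_feasible E k"
    "\<And>Y. Y \<in> theta_feasible E k \<Longrightarrow> trace_inner all_ones Y \<le> trace_inner all_ones X"
    using continuous_attains_sup[OF comp _ continuous_on_trace_inner_all_ones] by blast
  then have "theta_k E k = trace_inner all_ones X"
    unfolding theta_k_def by (intro Greatest_equality) auto
  with X show "theta_k E k \<in> trace_inner all_ones ` theta_feasible E k"
    and "\<And>X. X \<in> theta_feasible E k \<Longrightarrow> trace_inner all_ones X \<le> theta_k E k"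
    by auto
qed

lemma mu_min:
  fixes E :: "'v::finite \<Rightarrow> 'v \<Rightarrow> bool"
  assumes "simple_graph E"
  shows "mu E \<in> {1..real CARD('v)}" and "theta_k E (mu E) = real CARD('v)"
    and "\<And>k. k \<in> {1..real CARD('v)} \<Longrightarrow> theta_k E k = real CARD('v) \<Longrightarrow> mu E \<le> k"
proof -
  let ?n = "real CARD('v)"
  have le: "trace_inner all_ones X \<le> ?n" if "X \<in> theta_feasible E k" for X k
  proof -
    have "0 \<le> (\<chi> i. 1) \<bullet> ((mat 1 - X) *v (\<chi> i. 1))"
      using that by (auto simp: theta_feasible_def loewner_le_def pos_semidef_def)
    then have "(\<chi> i. 1) \<bullet> (X *v (\<chi> i. 1)) \<le> (\<chi> i. 1) \<bullet> ((\<chi> i. 1) :: real^'v)"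
      by (simp add: matrix_vector_mult_diff_rdistrib inner_diff_right)
    then show ?thesis
      by (simp add: trace_inner_all_ones inner_vec_def matrix_vector_mult_def)
  qed
  let ?S = "relaxed_feasible E \<inter> {X. trace_inner all_ones X = ?n}
              \<inter> {X. 1 \<le> trace_inner (mat 1) X} \<inter> {X. trace_inner (mat 1) X \<le> ?n}"
  have opt: "k \<in> {1..?n} \<and> theta_k E k = ?n \<longleftrightarrow> k \<in> trace_inner (mat 1) ` ?S" (is "?L \<longleftrightarrow> ?R")
    for k
  proof
    assume ?L
    then obtain X where "X \<in> theta_feasible E k" "trace_inner all_ones X = ?n"
      using theta_k_max(1)[OF assms, of k] by auto
    with \<open>?L\<close> show ?R by (auto simp: theta_feasible_relaxed)
  next
    assume ?R
    then obtain X where X: "X \<in> theta_feasible E k" "trace_inner all_ones X = ?n"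
      and k: "1 \<le> k" "k \<le> ?n"
      by (auto simp: theta_feasible_relaxed)
    obtain Y where "Y \<in> theta_feasible E k" "theta_k E k = trace_inner all_ones Y"
      using theta_k_max(1)[OF assms k] by auto
    then have "theta_k E k \<le> ?n"
      using le by simp
    with theta_k_max(2)[OF assms k X(1)] X(2) k show ?L by auto
  qed
  have "compact ?S"
    by (intro compact_Int_closed compact_relaxed_feasible closed_Collect_eq closed_Collect_le
        continuous_on_trace_inner_all_ones continuous_on_trace_inner_mat_1 continuous_on_const)
  then have comp: "compact (trace_inner (mat 1) ` ?S)"
    by (intro compact_continuous_image continuous_on_trace_inner_mat_1)
  have one: "1 \<le> ?n"
    by (simp add: Suc_leI)
  have "mat 1 \<in> theta_feasible E ?n"
    using scaled_mat_1_feasible[OF assms, of 1] by simp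
  moreover have "trace_inner all_ones (mat 1 :: real^'v^'v) = ?n"
    by (simp add: trace_inner_all_ones mat_def)
  ultimately have "mat 1 \<in> ?S"
    using one by (auto simp: theta_feasible_relaxed)
  then have "trace_inner (mat 1) ` ?S \<noteq> {}" by blast
  from compact_attains_inf[OF comp this] obtain k
    where k: "k \<in> trace_inner (mat 1) ` ?S" "\<And>l. l \<in> trace_inner (mat 1) ` ?S \<Longrightarrow> k \<le> l"
    by blast
  then have "mu E = k"
    unfolding mu_def opt by (intro Least_equality) auto
  moreover have "k \<in> {1..?n} \<and> theta_k E k = ?n"
    using k(1) by (simp only: opt)
  ultimately show "mu E \<in> {1..?n}" "theta_k E (mu E) = ?n"
    by simp_all
  show "mu E \<le> l" if "l \<in> {1..?n}" "theta_k E l = ?n" for l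
    unfolding \<open>mu E = k\<close> by (rule k(2), rule opt[THEN iffD1], rule conjI[OF that])
qed

end

theory Submission
  imports Defs
begin

text \<open>
  Write \<open>n\<close> for the number of vertices, \<open>J\<close> for the all-ones matrix, \<open>\<theta>\<close> for the theta number of \<open>E\<close>
  and \<open>\<theta>'\<close> for that of its complement. The theorem follows from the cycle of inequalities
  \<open>mu E \<le> n / \<theta> \<le> \<theta>' \<le> mu E\<close>.

  The middle inequality \<open>n \<le> \<theta> * \<theta>'\<close> holds for every graph
  (\<open>card_le_theta_mult_theta_complement\<close>). It is semidefinite duality: for each \<open>t > \<theta>\<close> some
  \<open>t I - J + S\<close> with \<open>S\<close> supported on the edges is positive semidefinite, and then
  \<open>t I + S\<close> is, up to scaling, feasible for the complement with objective value at least \<open>n / t\<close>.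

  The outer two need the algebra. Orthogonal projection onto a self-adjoint matrix algebra preserves
  positive semidefiniteness, and for a partially coherent algebra it also preserves the trace, the sum
  of the entries and the vanishing on edges (\<open>algebra_projection\<close>). So optimal matrices may be taken
  in the algebra, where homogeneity makes their diagonals and, because \<open>J\<close> lies in the algebra, also
  their row sums constant.

  For \<open>mu E \<le> n / \<theta>\<close>, take an optimal matrix \<open>W\<close> for \<open>\<theta>\<close> with constant diagonal. No eigenvalue of
  \<open>W\<close> exceeds \<open>\<theta> / n\<close>, because conjugating \<open>W\<close> by a diagonal matrix again gives a competitor for
  \<open>\<theta>\<close>; hence \<open>(n / \<theta>) W\<close> is feasible for \<open>k = n / \<theta>\<close> with sum of entries \<open>n\<close>.

  For \<open>\<theta>' \<le> mu E\<close>, a matrix attaining \<open>mu E\<close> becomes, after projection, a matrix \<open>Y\<close> with diagonal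
  \<open>mu E / n\<close> that fixes the all-ones vector. Thus \<open>Y - J / n\<close> is positive semidefinite, and pairing it
  with an optimal matrix for the complement gives the bound.
\<close>

section \<open>Positive semidefinite matrices\<close>

definition outer :: "real^'v \<Rightarrow> real^'v^'v" where
  "outer v = (\<chi> i j. v $ i * v $ j)"

lemma inner_matrix: "A \<bullet> B = (\<Sum>i\<in>UNIV. \<Sum>j\<in>UNIV. A $ i $ j * B $ i $ j)"
  for A B :: "real^'v::finite^'v"
  by (simp add: inner_vec_def)

lemma inner_outer: "X \<bullet> outer v = v \<bullet> (X *v v)"
  for X :: "real^'v::finite^'v"
  unfolding inner_matrix outer_def quadratic_form by (simp add: mult_ac)

lemma trace_inner_all_ones_eq_inner: "trace_inner all_ones X = all_ones \<bullet> X"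
  unfolding trace_inner_all_ones inner_matrix by (simp add: all_ones_def)

lemma trace_inner_mat_1_eq_inner: "trace_inner (mat 1) X = mat 1 \<bullet> X"
  unfolding trace_inner_mat_1 inner_matrix
  by (simp add: mat_def if_distrib[of "\<lambda>a. a * _"] cong: if_cong)

lemma quadratic_form_outer: "w \<bullet> (outer v *v w) = (v \<bullet> w)\<^sup>2"
  for v w :: "real^'v::finite"
  unfolding quadratic_form outer_def power2_eq_square
  by (simp add: inner_vec_def sum_product mult_ac)

lemma pos_semidef_outer: "pos_semidef (outer v)"
  by (simp add: pos_semidef_def quadratic_form_outer)
     (simp add: outer_def transpose_def vec_eq_iff mult.commute)

lemma pos_semidef_entry_commute: "pos_semidef X \<Longrightarrow> X $ i $ j = X $ j $ i"
  unfolding pos_semidef_def transpose_def vec_eq_iff by simp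

lemma pos_semidef_nonneg: "pos_semidef X \<Longrightarrow> 0 \<le> v \<bullet> (X *v v)"
  by (simp add: pos_semidef_def)

lemma pos_semidef_scaleR: "pos_semidef X \<Longrightarrow> 0 \<le> c \<Longrightarrow> pos_semidef (c *\<^sub>R X)"
  by (simp add: pos_semidef_def scaleR_matrix_vector_assoc[symmetric])
     (simp add: transpose_def vec_eq_iff)

lemma pos_semidef_add: "pos_semidef X \<Longrightarrow> pos_semidef Y \<Longrightarrow> pos_semidef (X + Y)"
  by (simp add: pos_semidef_def matrix_vector_mult_add_rdistrib inner_add_right)
     (simp add: transpose_def vec_eq_iff)

lemma inner_matrix_vector_commute:
  fixes X :: "real^'v::finite^'v"
  assumes "transpose X = X"
  shows "v \<bullet> (X *v w) = w \<bullet> (X *v v)"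
  by (metis assms dot_lmul_matrix inner_commute transpose_matrix_vector)

lemma quadratic_form_add_scaleR:
  fixes X :: "real^'v::finite^'v"
  assumes "transpose X = X"
  shows "(v + c *\<^sub>R w) \<bullet> (X *v (v + c *\<^sub>R w))
    = v \<bullet> (X *v v) + 2 * c * (w \<bullet> (X *v v)) + c\<^sup>2 * (w \<bullet> (X *v w))"
  using inner_matrix_vector_commute[OF assms, of v w]
  by (simp add: matrix_vector_right_distrib matrix_vector_mult_scaleR inner_add_left
      inner_add_right power2_eq_square algebra_simps)

text \<open>
  Where the form vanishes it attains its minimum, so its gradient \<open>2 X v\<close> vanishes there: moving
  from \<open>v\<close> a short way in the direction \<open>- X v\<close> would make the form negative.
\<close>
lemma pos_semidef_isotropic:
  assumes X: "pos_semidef X" and v: "v \<bullet> (X *v v) = 0"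
  shows "X *v v = 0"
proof (rule ccontr)
  define w where "w = X *v v"
  assume "X *v v \<noteq> 0"
  then have a: "0 < w \<bullet> w" by (simp add: w_def)
  have q: "0 \<le> 2 * c * (w \<bullet> w) + c\<^sup>2 * (w \<bullet> (X *v w))" for c
    using pos_semidef_nonneg[OF X, of "v + c *\<^sub>R w"] X v
    by (simp add: quadratic_form_add_scaleR pos_semidef_def flip: w_def)
  define b where "b = w \<bullet> (X *v w)"
  have b: "0 \<le> b" using pos_semidef_nonneg[OF X] by (simp add: b_def)
  \<comment> \<open>The step length along \<open>- w\<close>; \<open>1 + b\<close> avoids a case distinction on \<open>b = 0\<close>.\<close>
  define e where "e = (w \<bullet> w) / (1 + b)"
  have e: "w \<bullet> w = e * (1 + b)" and "e \<noteq> 0"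
    using a b by (auto simp: e_def)
  have "2 * (- e) * (w \<bullet> w) + (- e)\<^sup>2 * b = e\<^sup>2 * (b - 2 * (1 + b))"
    unfolding e by algebra
  also have "\<dots> < 0"
    using \<open>e \<noteq> 0\<close> b by (intro mult_pos_neg) auto
  finally show False using q[of "- e"] by (simp add: b_def)
qed

lemma pos_semidef_diag_nonneg:
  "pos_semidef X \<Longrightarrow> 0 \<le> X $ i $ i"
  using pos_semidef_nonneg[of X "axis i 1"]
  by (simp add: inner_axis' matrix_vector_mult_basis column_def)

lemma pos_semidef_zero_diag:
  assumes X: "pos_semidef X" and "X $ i $ i = 0"
  shows "X $ i $ j = 0"
proof -
  have "X *v axis i 1 = 0"
    using assms by (intro pos_semidef_isotropic)
      (simp_all add: inner_axis' matrix_vector_mult_basis column_def)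
  then show ?thesis
    using pos_semidef_entry_commute[OF X, of i j]
    by (simp add: matrix_vector_mult_basis column_def vec_eq_iff)
qed

text \<open>
  One step of Cholesky elimination: the quadratic form of the reduced matrix at \<open>v\<close> is the minimum
  of the form of \<open>Y\<close> over the line through \<open>v\<close> in the direction of the \<open>i\<close>-th basis vector.
\<close>
lemma pos_semidef_eliminate:
  fixes Y :: "real^'v::finite^'v"
  assumes Y: "pos_semidef Y" and i: "Y $ i $ i \<noteq> 0"
  shows "pos_semidef (Y - (1 / Y $ i $ i) *\<^sub>R outer (Y $ i))"
proof -
  let ?Z = "Y - (1 / Y $ i $ i) *\<^sub>R outer (Y $ i)"
  have sym: "transpose Y = Y" using Y by (simp add: pos_semidef_def)
  have row: "axis i 1 \<bullet> (Y *v v) = Y $ i \<bullet> v" for v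
    by (simp add: inner_axis' matrix_vector_mult_def) (simp add: inner_vec_def)
  have "v \<bullet> (?Z *v v) =
      (v + (- (Y $ i \<bullet> v) / Y $ i $ i) *\<^sub>R axis i 1) \<bullet>
        (Y *v (v + (- (Y $ i \<bullet> v) / Y $ i $ i) *\<^sub>R axis i 1))" for v
  proof -
    have "v \<bullet> (?Z *v v) = v \<bullet> (Y *v v) - (Y $ i \<bullet> v)\<^sup>2 / Y $ i $ i"
      by (simp add: matrix_vector_mult_diff_rdistrib inner_diff_right quadratic_form_outer
          scaleR_matrix_vector_assoc[symmetric])
    then show ?thesis
      using i unfolding quadratic_form_add_scaleR[OF sym] row
      by (simp add: inner_axis power2_eq_square field_simps)
  qed
  moreover have "transpose ?Z = ?Z"
    using pos_semidef_entry_commute[OF Y]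
    by (simp add: transpose_def vec_eq_iff outer_def mult.commute)
  ultimately show ?thesis
    using pos_semidef_nonneg[OF Y] by (simp add: pos_semidef_def)
qed

text \<open>
  The cone of positive semidefinite matrices is contained in its dual. Cholesky elimination, which
  clears one diagonal entry at a time, reduces \<open>Y\<close> to a sum of matrices \<open>outer v\<close>, and the pairing of
  \<open>X\<close> with \<open>outer v\<close> is the value of the form of \<open>X\<close> at \<open>v\<close>.
\<close>
lemma pos_semidef_inner_nonneg:
  fixes X Y :: "real^'v::finite^'v"
  assumes X: "pos_semidef X" and "pos_semidef Y"
  shows "0 \<le> X \<bullet> Y"
  using assms(2)
proof (induction "card {i. Y $ i $ i \<noteq> 0}" arbitrary: Y rule: less_induct)
  case less
  show ?case
  proof (cases "\<exists>i. Y $ i $ i \<noteq> 0")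
    case False
    then have "Y = 0"
      using pos_semidef_zero_diag[OF less.prems] by (simp add: vec_eq_iff)
    then show ?thesis by simp
  next
    case True
    then obtain i where i: "Y $ i $ i \<noteq> 0" by blast
    let ?Z = "Y - (1 / Y $ i $ i) *\<^sub>R outer (Y $ i)"
    have Z: "pos_semidef ?Z"
      using pos_semidef_eliminate[OF less.prems i] .
    have "?Z $ j $ j = 0" if "Y $ j $ j = 0" for j
      using pos_semidef_zero_diag[OF less.prems that, of i]
        pos_semidef_entry_commute[OF less.prems, of i j] that by (simp add: outer_def)
    moreover have "?Z $ i $ i = 0"
      using i by (simp add: outer_def)
    ultimately have "{j. ?Z $ j $ j \<noteq> 0} \<subset> {j. Y $ j $ j \<noteq> 0}"
      using i by blast
    then have "0 \<le> X \<bullet> ?Z"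
      using less.hyps Z by (simp add: psubset_card_mono)
    moreover have "0 \<le> (1 / Y $ i $ i) * (X \<bullet> outer (Y $ i))"
      using pos_semidef_nonneg[OF X] pos_semidef_diag_nonneg[OF less.prems, of i]
      by (simp add: inner_outer)
    ultimately show ?thesis
      by (simp add: inner_diff_right)
  qed
qed

lemma pos_semidef_mat_1: "pos_semidef (mat 1)"
  by (simp add: pos_semidef_def)

lemma pos_semidef_norm_minus_outer:
  "pos_semidef ((v \<bullet> v) *\<^sub>R mat 1 - outer v)"
proof -
  have "0 \<le> w \<bullet> (((v \<bullet> v) *\<^sub>R mat 1 - outer v) *v w)" for w
    using Cauchy_Schwarz_ineq[of v w]
    by (simp add: matrix_vector_mult_diff_rdistrib inner_diff_right quadratic_form_outer
        scaleR_matrix_vector_assoc[symmetric])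
  then show ?thesis
    by (simp add: pos_semidef_def)
       (simp add: outer_def mat_def transpose_def vec_eq_iff mult.commute)
qed

text \<open>
  The largest eigenvalue is at most the trace. The proof pairs \<open>X\<close> with the matrix
  \<open>(v \<bullet> v) I - outer v\<close>, which Cauchy-Schwarz shows to be positive semidefinite.
\<close>
lemma quadratic_form_le_trace:
  assumes "pos_semidef X"
  shows "v \<bullet> (X *v v) \<le> (mat 1 \<bullet> X) * (v \<bullet> v)"
  using pos_semidef_inner_nonneg[OF assms pos_semidef_norm_minus_outer[of v]]
  by (simp add: inner_diff_right inner_outer inner_commute mult.commute)

section \<open>Projection onto a self-adjoint matrix algebra\<close>

lemma inner_transpose: "transpose P \<bullet> Q = P \<bullet> transpose Q"
  for P Q :: "real^'v::finite^'v"
  unfolding inner_matrix transpose_def by simp (rule sum.swap)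

lemma inner_matrix_mult:
  fixes A B C :: "real^'v::finite^'v"
  shows "A \<bullet> (B ** transpose C) = (A ** C) \<bullet> B"
proof -
  have "A \<bullet> (B ** transpose C) = (\<Sum>i\<in>UNIV. \<Sum>j\<in>UNIV. \<Sum>k\<in>UNIV. A $ i $ j * (B $ i $ k * C $ j $ k))"
    by (simp add: inner_matrix matrix_matrix_mult_def transpose_def sum_distrib_left)
  also have "\<dots> = (\<Sum>i\<in>UNIV. \<Sum>k\<in>UNIV. \<Sum>j\<in>UNIV. A $ i $ j * (B $ i $ k * C $ j $ k))"
    by (intro sum.cong refl sum.swap)
  also have "\<dots> = (A ** C) \<bullet> B"
    by (simp add: inner_matrix matrix_matrix_mult_def sum_distrib_left sum_distrib_right mult_ac)
  finally show ?thesis .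
qed

lemma pos_semidef_gram: "pos_semidef (B ** transpose B)"
  for B :: "real^'v::finite^'v"
proof -
  have "v \<bullet> ((B ** transpose B) *v v) = (transpose B *v v) \<bullet> (transpose B *v v)" for v
    by (simp add: matrix_vector_mul_assoc[symmetric] dot_lmul_matrix[symmetric] transpose_matrix_vector)
  then show ?thesis
    by (simp add: pos_semidef_def matrix_transpose_mul)
qed

text \<open>
  Left multiplication by \<open>M\<close> maps the finite-dimensional algebra to itself. Were it injective, it
  would be surjective, the algebra would contain a right inverse of \<open>M\<close>, and \<open>M\<close> would be regular.
\<close>
lemma singular_annihilates_in_algebra:
  fixes M :: "real^'v::finite^'v"
  assumes alg: "matrix_subalgebra \<A>" and one: "mat 1 \<in> \<A>" and M: "M \<in> \<A>"
    and sing: "v \<noteq> 0" "transpose M *v v = 0"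
  obtains B where "B \<in> \<A>" "B \<noteq> 0" "M ** B = 0"
proof (rule ccontr)
  assume neg: "\<not> thesis"
  have sub: "subspace \<A>" using alg by (simp add: matrix_subalgebra_def)
  have lin: "linear ((**) M)"
    by (intro linearI)
       (simp_all add: matrix_add_ldistrib matrix_matrix_mult_def vec_eq_iff sum_distrib_left
        sum.distrib algebra_simps)
  have "inj_on ((**) M) \<A>"
    using neg that lin linear_injective_on_subspace_0[OF lin sub] by blast
  then have "dim ((**) M ` \<A>) = dim \<A>"
    by (simp add: dim_image_eq lin sub span_eq_iff[THEN iffD2])
  moreover have "(**) M ` \<A> \<subseteq> \<A>"
    using alg M by (auto simp: matrix_subalgebra_def)
  ultimately have "(**) M ` \<A> = \<A>"
    using sub by (intro subspace_dim_equal linear_subspace_image[OF lin]) auto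
  then obtain B where "mat 1 = M ** B" using one by (metis imageE)
  then have "mat 1 = transpose B ** transpose M"
    by (metis matrix_transpose_mul transpose_mat)
  then have "v = transpose B *v (transpose M *v v)"
    by (metis matrix_vector_mul_assoc matrix_vector_mul_lid)
  then show False using sing by simp
qed

text \<open>
  The minimum of the quadratic form on the unit sphere is an eigenvalue, and a minimizing vector is
  an eigenvector by \<open>pos_semidef_isotropic\<close> applied to the shifted matrix.
\<close>
lemma rayleigh_minimum:
  fixes Y :: "real^'v::finite^'v"
  assumes sym: "transpose Y = Y" and neg: "w \<bullet> (Y *v w) < 0"
  obtains l v where "l < 0" "v \<noteq> 0" "Y *v v = l *\<^sub>R v"
proof -
  have cont: "continuous_on (sphere 0 1) (\<lambda>v. v \<bullet> (Y *v v))"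
    unfolding quadratic_form by (intro continuous_intros)
  then obtain v where v: "v \<in> sphere 0 1"
    and min: "\<And>u. u \<in> sphere 0 1 \<Longrightarrow> v \<bullet> (Y *v v) \<le> u \<bullet> (Y *v u)"
    using continuous_attains_inf[OF _ _ cont] by auto
  define l where "l = v \<bullet> (Y *v v)"
  have low: "l * (u \<bullet> u) \<le> u \<bullet> (Y *v u)" for u
  proof (cases "u = 0")
    case False
    have "l \<le> (u /\<^sub>R norm u) \<bullet> (Y *v (u /\<^sub>R norm u))"
      unfolding l_def using False by (intro min) simp
    also have "\<dots> = (u \<bullet> (Y *v u)) / (u \<bullet> u)"
      by (simp only: matrix_vector_mult_scaleR inner_scaleR_left inner_scaleR_right
          dot_square_norm power2_eq_square inverse_mult_distrib divide_inverse mult_ac)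
    finally show ?thesis using False by (simp add: pos_le_divide_eq)
  qed simp
  have vv: "v \<bullet> v = 1" using v dot_square_norm[of v] by simp
  have "pos_semidef (Y - l *\<^sub>R mat 1)"
  proof -
    have "transpose (Y - l *\<^sub>R mat 1) = transpose Y - l *\<^sub>R mat 1"
      by (simp add: transpose_def mat_def vec_eq_iff)
    then show ?thesis
      using low sym by (simp add: pos_semidef_def matrix_vector_mult_diff_rdistrib inner_diff_right
          scaleR_matrix_vector_assoc[symmetric])
  qed
  moreover have "v \<bullet> ((Y - l *\<^sub>R mat 1) *v v) = 0"
    using vv by (simp add: matrix_vector_mult_diff_rdistrib inner_diff_right
        scaleR_matrix_vector_assoc[symmetric] l_def)
  ultimately have "(Y - l *\<^sub>R mat 1) *v v = 0" by (rule pos_semidef_isotropic)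
  then have "Y *v v = l *\<^sub>R v"
    by (simp add: matrix_vector_mult_diff_rdistrib scaleR_matrix_vector_assoc[symmetric])
  moreover have "l * (w \<bullet> w) < 0" using low[of w] neg by linarith
  then have "l < 0" using inner_ge_zero[of w] by (simp add: mult_less_0_iff)
  moreover have "v \<noteq> 0" using vv by auto
  ultimately show thesis using that by blast
qed

text \<open>
  Inside a unital algebra, positive semidefiniteness can be tested against the Gram matrices of
  elements of the algebra. If \<open>Y\<close> had a negative eigenvalue \<open>l\<close>, then \<open>Y - l I\<close> would be singular, so the
  algebra would contain some \<open>B \<noteq> 0\<close> with \<open>Y B = l B\<close>, and the pairing of \<open>Y\<close> with \<open>B B\<^sup>T\<close> would be
  \<open>l * (B \<bullet> B) < 0\<close>. The matrix \<open>B\<close> replaces the spectral projection of \<open>Y\<close> for \<open>l\<close>.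
\<close>
lemma pos_semidef_in_algebra:
  fixes Y :: "real^'v::finite^'v"
  assumes alg: "matrix_subalgebra \<A>" and one: "mat 1 \<in> \<A>"
    and Y: "Y \<in> \<A>" "transpose Y = Y"
    and gram: "\<And>B. B \<in> \<A> \<Longrightarrow> 0 \<le> Y \<bullet> (B ** transpose B)"
  shows "pos_semidef Y"
proof (rule ccontr)
  assume "\<not> pos_semidef Y"
  then obtain w where "w \<bullet> (Y *v w) < 0"
    using Y by (auto simp: pos_semidef_def not_le)
  then obtain l v where l: "l < 0" "v \<noteq> 0" "Y *v v = l *\<^sub>R v"
    using rayleigh_minimum[OF Y(2)] by blast
  let ?M = "Y - l *\<^sub>R mat 1"
  have tM: "transpose ?M = ?M"
    using Y(2) by (simp add: transpose_def mat_def vec_eq_iff)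
  have "?M \<in> \<A>"
    using alg one Y(1) by (simp add: matrix_subalgebra_def subspace_diff subspace_scale)
  moreover have "transpose ?M *v v = 0"
    unfolding tM using l by (simp add: matrix_vector_mult_diff_rdistrib scaleR_matrix_vector_assoc[symmetric])
  ultimately obtain B where B: "B \<in> \<A>" "B \<noteq> 0" "?M ** B = 0"
    using singular_annihilates_in_algebra[OF alg one _ l(2)] by blast
  have "?M ** B = Y ** B - l *\<^sub>R B"
    by (simp add: matrix_matrix_mult_def vec_eq_iff left_diff_distrib sum_subtractf mult.assoc
        flip: sum_distrib_left)
      (simp add: mat_def if_distrib[of "\<lambda>a. a * _"] cong: if_cong)
  then have "Y ** B = l *\<^sub>R B" using B(3) by simp
  then have "Y \<bullet> (B ** transpose B) = l * (B \<bullet> B)"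
    by (simp add: inner_matrix_mult)
  also have "\<dots> < 0" using l(1) B(2) by (simp add: mult_neg_pos)
  finally show False using gram[OF B(1)] by simp
qed

text \<open>
  The witness is the orthogonal projection of \<open>X\<close>. It has the same inner product as \<open>X\<close> with every
  matrix of the algebra. Transposition and the Schur product with the adjacency matrix are
  self-adjoint maps preserving the algebra, so they commute with the projection.
\<close>
lemma algebra_projection:
  fixes E :: "'v::finite \<Rightarrow> 'v \<Rightarrow> bool"
  assumes A: "partially_coherent_algebra E \<A>"
    and X: "pos_semidef X" "schur_product (adjacency_matrix E) X = 0"
  obtains Y where "Y \<in> \<A>" "pos_semidef Y" "schur_product (adjacency_matrix E) Y = 0"
    "mat 1 \<bullet> Y = mat 1 \<bullet> X" "all_ones \<bullet> Y = all_ones \<bullet> X"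
proof -
  have alg: "matrix_subalgebra \<A>" and one: "mat 1 \<in> \<A>" and J: "all_ones \<in> \<A>"
    and tr: "\<And>M. M \<in> \<A> \<Longrightarrow> transpose M \<in> \<A>"
    and sch: "\<And>M. M \<in> \<A> \<Longrightarrow> schur_product (adjacency_matrix E) M \<in> \<A>"
    using A by (auto simp: partially_coherent_algebra_def)
  have sub: "subspace \<A>" using alg by (simp add: matrix_subalgebra_def)
  obtain Y Z where Y: "Y \<in> \<A>" and Z: "\<And>W. W \<in> \<A> \<Longrightarrow> Z \<bullet> W = 0" and XYZ: "X = Y + Z"
    using orthogonal_subspace_decomp_exists[of \<A> X]
    by (metis sub span_eq_iff orthogonal_def)
  have same: "Y \<bullet> W = X \<bullet> W" if "W \<in> \<A>" for W
    using Z[OF that] by (simp add: XYZ inner_add_left)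
  \<comment> \<open>\<open>?D\<close> lies in the algebra and, \<open>X\<close> being symmetric, is orthogonal to it.\<close>
  let ?D = "transpose Y - Y"
  have D: "?D \<in> \<A>" using Y tr sub by (simp add: subspace_diff)
  have "transpose Y \<bullet> ?D = X \<bullet> transpose ?D"
    using same tr[OF D] by (simp add: inner_transpose)
  also have "\<dots> = transpose X \<bullet> ?D" by (simp add: inner_transpose)
  also have "\<dots> = Y \<bullet> ?D"
    using X(1) same[OF D] by (simp add: pos_semidef_def)
  finally have "?D \<bullet> ?D = 0" by (simp add: inner_diff_left)
  then have symY: "transpose Y = Y" by simp
  have psd: "pos_semidef Y"
  proof (rule pos_semidef_in_algebra[OF alg one Y symY])
    fix B assume "B \<in> \<A>"
    then have "Y \<bullet> (B ** transpose B) = X \<bullet> (B ** transpose B)"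
      using alg tr by (intro same) (auto simp: matrix_subalgebra_def)
    then show "0 \<le> Y \<bullet> (B ** transpose B)"
      using pos_semidef_inner_nonneg[OF X(1) pos_semidef_gram] by simp
  qed
  let ?S = "schur_product (adjacency_matrix E)"
  \<comment> \<open>The adjacency matrix has entries 0 and 1, so its Schur product is idempotent.\<close>
  have "?S Y \<bullet> ?S Y = Y \<bullet> ?S Y"
    unfolding inner_matrix schur_product_def adjacency_matrix_def
    by (intro sum.cong refl) simp
  also have "\<dots> = X \<bullet> ?S Y" by (rule same[OF sch[OF Y]])
  also have "\<dots> = ?S X \<bullet> Y"
    unfolding inner_matrix schur_product_def by (simp add: mult_ac)
  also have "\<dots> = 0" by (simp add: X(2))
  finally have "?S Y = 0" by simp
  then show thesis
    using that[of Y] Y psd same[OF one] same[OF J] by (simp add: inner_commute)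
qed

section \<open>The theta number as a ratio of trace and sum of entries\<close>

lemma schur_product_adjacency_eq_0:
  "schur_product (adjacency_matrix E) X = 0 \<longleftrightarrow> (\<forall>i j. E i j \<longrightarrow> X $ i $ j = 0)"
  by (auto simp: schur_product_def adjacency_matrix_def vec_eq_iff)

lemma all_ones_eq_outer: "all_ones = outer 1"
  by (simp add: all_ones_def outer_def)

lemma inner_all_ones_all_ones: "(all_ones :: real^'v^'v::finite) \<bullet> all_ones = (real CARD('v))\<^sup>2"
  by (simp add: inner_matrix all_ones_def power2_eq_square)

lemma inner_mat_1: "mat 1 \<bullet> X = (\<Sum>i\<in>UNIV. X $ i $ i)"
  by (simp flip: trace_inner_mat_1_eq_inner trace_inner_mat_1)

lemma inner_one_one: "(1 :: real^'v::finite) \<bullet> 1 = real CARD('v)"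
  by (simp add: inner_vec_def)

lemma theta_feasible_iff:
  "X \<in> theta_feasible E k \<longleftrightarrow>
    pos_semidef X \<and> pos_semidef (mat 1 - X) \<and> (\<forall>i j. E i j \<longrightarrow> X $ i $ j = 0) \<and> mat 1 \<bullet> X = k"
  by (auto simp: theta_feasible_def loewner_le_def trace_inner_mat_1_eq_inner pos_semidef_def
      schur_product_adjacency_eq_0)

lemma pos_semidef_trace_0:
  assumes "pos_semidef X" "mat 1 \<bullet> X = 0"
  shows "X = 0"
proof -
  have "X $ i $ i = 0" for i
    using assms(2) pos_semidef_diag_nonneg[OF assms(1)]
    by (simp add: inner_mat_1 sum_nonneg_eq_0_iff)
  then show ?thesis
    using pos_semidef_zero_diag[OF assms(1)] by (simp add: vec_eq_iff)
qed

lemma trace_nonneg: "pos_semidef X \<Longrightarrow> 0 \<le> mat 1 \<bullet> X"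
  unfolding inner_mat_1 by (intro sum_nonneg pos_semidef_diag_nonneg)

text \<open>
  At trace 1 no eigenvalue exceeds 1, so the upper bound by \<open>I\<close> is automatic. The remaining
  constraints define a cone cut by the trace, which is what permits the scaling in
  \<open>inner_all_ones_le_theta\<close>.
\<close>
lemma theta_feasible_1_iff:
  "X \<in> theta_feasible E 1 \<longleftrightarrow>
    pos_semidef X \<and> (\<forall>i j. E i j \<longrightarrow> X $ i $ j = 0) \<and> mat 1 \<bullet> X = 1"
proof -
  have "pos_semidef (mat 1 - X)" if X: "pos_semidef X" "mat 1 \<bullet> X = 1"
  proof -
    have "transpose (mat 1 - X) = mat 1 - transpose X"
      by (simp add: transpose_def mat_def vec_eq_iff)
    then show ?thesis
      using X quadratic_form_le_trace[OF X(1)]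
      by (simp add: pos_semidef_def matrix_vector_mult_diff_rdistrib inner_diff_right)
  qed
  then show ?thesis by (auto simp: theta_feasible_iff)
qed

lemma one_le_CARD: "1 \<le> real CARD('v::finite)"
  by (simp add: Suc_leI)

lemma lovasz_theta_attained:
  fixes E :: "'v::finite \<Rightarrow> 'v \<Rightarrow> bool"
  assumes "simple_graph E"
  obtains W where "pos_semidef W" "\<And>i j. E i j \<Longrightarrow> W $ i $ j = 0" "mat 1 \<bullet> W = 1"
    "all_ones \<bullet> W = lovasz_theta E"
  using theta_k_max(1)[OF assms order_refl one_le_CARD]
  by (auto simp: theta_feasible_1_iff lovasz_theta_def trace_inner_all_ones_eq_inner)

lemma inner_all_ones_le_theta:
  fixes E :: "'v::finite \<Rightarrow> 'v \<Rightarrow> bool"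
  assumes "simple_graph E" and X: "pos_semidef X" and zero: "\<And>i j. E i j \<Longrightarrow> X $ i $ j = 0"
  shows "all_ones \<bullet> X \<le> lovasz_theta E * (mat 1 \<bullet> X)"
proof (cases "mat 1 \<bullet> X = 0")
  case True
  then show ?thesis using pos_semidef_trace_0[OF X] by simp
next
  case False
  then have pos: "0 < mat 1 \<bullet> X" using trace_nonneg[OF X] by linarith
  let ?Y = "(1 / (mat 1 \<bullet> X)) *\<^sub>R X"
  have "?Y \<in> theta_feasible E 1"
    using zero pos pos_semidef_scaleR[OF X, of "1 / (mat 1 \<bullet> X)"] by (simp add: theta_feasible_1_iff)
  then have "all_ones \<bullet> ?Y \<le> lovasz_theta E"
    using theta_k_max(2)[OF assms(1) order_refl one_le_CARD, of ?Y]
    by (simp add: lovasz_theta_def trace_inner_all_ones_eq_inner)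
  then show ?thesis using pos by (simp add: pos_divide_le_eq)
qed

lemma lovasz_theta_bounds:
  fixes E :: "'v::finite \<Rightarrow> 'v \<Rightarrow> bool"
  assumes "simple_graph E"
  shows "1 \<le> lovasz_theta E" and "lovasz_theta E \<le> real CARD('v)"
proof -
  have tr: "mat 1 \<bullet> (mat 1 :: real^'v^'v) = real CARD('v)"
    unfolding inner_mat_1 by (simp add: mat_def)
  have "all_ones \<bullet> (mat 1 :: real^'v^'v) = real CARD('v)"
    unfolding inner_commute[of all_ones] inner_mat_1 by (simp add: all_ones_def)
  moreover have "all_ones \<bullet> (mat 1 :: real^'v^'v) \<le> lovasz_theta E * (mat 1 \<bullet> (mat 1 :: real^'v^'v))"
    using assms by (intro inner_all_ones_le_theta pos_semidef_mat_1)
      (auto simp: simple_graph_def irreflp_def mat_def)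
  ultimately have "real CARD('v) \<le> lovasz_theta E * real CARD('v)"
    by (simp add: tr)
  then show "1 \<le> lovasz_theta E" by simp
  obtain W where W: "pos_semidef W" "\<And>i j. E i j \<Longrightarrow> W $ i $ j = 0" "mat 1 \<bullet> W = 1"
    "all_ones \<bullet> W = lovasz_theta E"
    using lovasz_theta_attained[OF assms] by blast
  have "all_ones \<bullet> W = 1 \<bullet> (W *v 1)"
    by (simp only: all_ones_eq_outer inner_outer inner_commute[of _ W])
  also have "\<dots> \<le> real CARD('v)"
    using quadratic_form_le_trace[OF W(1), of 1] W(3) by (simp add: inner_one_one)
  finally show "lovasz_theta E \<le> real CARD('v)" by (simp add: W(4))
qed

section \<open>Duality\<close>

lemma simple_graph_sym: "simple_graph E \<Longrightarrow> E i j \<Longrightarrow> E j i"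
  by (auto simp: simple_graph_def dest: sympD)

lemma nonneg_if_ray_bounded_below:
  fixes x b :: real
  assumes "\<And>c. 0 \<le> c \<Longrightarrow> b \<le> c * x"
  shows "0 \<le> x"
proof (rule ccontr)
  assume "\<not> 0 \<le> x"
  moreover have "b \<le> 0" using assms[of 0] by simp
  ultimately have "0 \<le> (1 - b) / (- x)" and "(1 - b) / (- x) * x = b - 1"
    by (auto simp: field_simps)
  then show False using assms[of "(1 - b) / (- x)"] by linarith
qed

lemma eq_0_if_line_bounded:
  fixes x b :: real
  assumes "\<And>c. b \<le> c * x"
  shows "x = 0"
proof (rule ccontr)
  assume "x \<noteq> 0"
  then show False using assms[of "(b - 1) / x"] by simp
qed

lemma quadratic_form_transpose: "v \<bullet> (transpose P *v v) = v \<bullet> (P *v v)"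
  for P :: "real^'v::finite^'v"
  by (metis dot_lmul_matrix inner_commute transpose_matrix_vector)

text \<open>
  A linear functional bounded below on a cone is nonnegative on it. The cone consists of all
  matrices with nonnegative quadratic form, not only the symmetric ones; it contains every
  antisymmetric matrix together with its negative, and this forces \<open>F\<close> to be symmetric.
\<close>
lemma pos_semidef_if_dual:
  fixes F :: "real^'v::finite^'v"
  assumes "\<And>P. (\<And>v. 0 \<le> v \<bullet> (P *v v)) \<Longrightarrow> b \<le> F \<bullet> P"
  shows "pos_semidef F"
proof -
  have "b \<le> c * (F \<bullet> (F - transpose F))" for c
  proof -
    have "b \<le> F \<bullet> (c *\<^sub>R (F - transpose F))"
      by (rule assms) (simp add: scaleR_matrix_vector_assoc[symmetric]
          matrix_vector_mult_diff_rdistrib inner_diff_right quadratic_form_transpose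
          del: transpose_matrix_vector)
    then show ?thesis by simp
  qed
  then have "F \<bullet> (F - transpose F) = 0" by (rule eq_0_if_line_bounded)
  moreover have "(F - transpose F) \<bullet> (F - transpose F) = 2 * (F \<bullet> (F - transpose F))"
    using inner_transpose[of F F] inner_transpose[of F "transpose F"]
    by (simp add: inner_diff_left inner_diff_right)
  ultimately have "transpose F = F" by simp
  moreover have "0 \<le> v \<bullet> (F *v v)" for v
  proof (rule nonneg_if_ray_bounded_below)
    fix c :: real assume "0 \<le> c"
    then have "b \<le> F \<bullet> (c *\<^sub>R outer v)"
      using pos_semidef_scaleR[OF pos_semidef_outer, of c v] by (intro assms pos_semidef_nonneg)
    then show "b \<le> c * (v \<bullet> (F *v v))" by (simp add: inner_outer)
  qed
  ultimately show ?thesis by (simp add: pos_semidef_def)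
qed

text \<open>
  Strong duality without attainment. If the affine space of the matrices \<open>t I - J + S\<close> missed the
  cone of nonnegative quadratic forms, a hyperplane would separate the two. Its normal matrix \<open>F\<close> is
  then positive semidefinite, vanishes on the edges, and has sum of entries at least \<open>t\<close> times its
  trace, which beats the theta number.
\<close>
lemma theta_dual_feasible:
  fixes E :: "'v::finite \<Rightarrow> 'v \<Rightarrow> bool"
  assumes E: "simple_graph E" and t: "lovasz_theta E < t"
  obtains S where "\<And>i j. \<not> E i j \<Longrightarrow> S $ i $ j = 0" "pos_semidef (t *\<^sub>R mat 1 - all_ones + S)"
proof -
  let ?B = "t *\<^sub>R mat 1 - all_ones :: real^'v^'v"
  let ?T = "{S :: real^'v^'v. \<forall>i j. \<not> E i j \<longrightarrow> S $ i $ j = 0}"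
  let ?L = "(+) ?B ` ?T"
  let ?P = "{P :: real^'v^'v. \<forall>v. 0 \<le> v \<bullet> (P *v v)}"
  have "?L \<inter> ?P \<noteq> {}"
  proof
    assume disj: "?L \<inter> ?P = {}"
    have "convex ?T" by (auto simp: convex_def)
    then have "convex ?L" by (rule convex_translation)
    moreover have "convex ?P"
      by (auto simp: convex_def matrix_vector_mult_add_rdistrib inner_add_right
          scaleR_matrix_vector_assoc[symmetric])
    moreover have "?L \<noteq> {}" by (auto intro!: exI[of _ 0])
    moreover have "?P \<noteq> {}" by (auto intro!: exI[of _ 0])
    ultimately obtain F b where F: "F \<noteq> 0" "\<And>x. x \<in> ?L \<Longrightarrow> F \<bullet> x \<le> b"
      "\<And>x. x \<in> ?P \<Longrightarrow> b \<le> F \<bullet> x"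
      using separating_hyperplane_sets[OF _ _ _ _ disj] by blast
    have psd: "pos_semidef F" using F(3) by (intro pos_semidef_if_dual) auto
    have edge: "F $ i $ j = 0" if "E i j" for i j
    proof (rule eq_0_if_line_bounded)
      fix c :: real
      have "F \<bullet> (?B + (- c) *\<^sub>R axis i (axis j 1)) \<le> b"
        using that by (intro F(2) imageI) (auto simp: axis_def)
      then show "F \<bullet> ?B - b \<le> c * F $ i $ j"
        by (simp add: inner_diff_right inner_axis algebra_simps)
    qed
    have "F \<bullet> ?B \<le> b" using F(2)[of ?B] by (force intro: image_eqI[of _ _ 0])
    moreover have "b \<le> 0" using F(3)[of 0] by simp
    ultimately have "t * (mat 1 \<bullet> F) \<le> all_ones \<bullet> F"
      by (simp add: inner_diff_right inner_commute)
    also have "\<dots> \<le> lovasz_theta E * (mat 1 \<bullet> F)"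
      by (rule inner_all_ones_le_theta[OF E psd edge])
    finally have "(t - lovasz_theta E) * (mat 1 \<bullet> F) \<le> 0" by (simp add: algebra_simps)
    then have "mat 1 \<bullet> F \<le> 0" using t by (simp add: mult_le_0_iff)
    then have "mat 1 \<bullet> F = 0" using trace_nonneg[OF psd] by simp
    then show False using pos_semidef_trace_0[OF psd] F(1) by simp
  qed
  then obtain S where S: "S \<in> ?T" "\<And>v. 0 \<le> v \<bullet> ((?B + S) *v v)" by blast
  \<comment> \<open>The separation ignores symmetry; symmetrizing \<open>S\<close> restores it without changing the form.\<close>
  define S' where "S' = (1/2) *\<^sub>R (S + transpose S)"
  have "v \<bullet> (S' *v v) = v \<bullet> (S *v v)" for v
    by (simp add: S'_def scaleR_matrix_vector_assoc[symmetric] matrix_vector_mult_add_rdistrib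
        inner_add_right quadratic_form_transpose del: transpose_matrix_vector)
  then have "0 \<le> v \<bullet> ((?B + S') *v v)" for v
    using S(2)[of v] by (simp add: matrix_vector_mult_add_rdistrib inner_add_right)
  moreover have "transpose (?B + S') = ?B + S'"
    by (simp add: transpose_def mat_def all_ones_def S'_def vec_eq_iff)
  ultimately have "pos_semidef (?B + S')" by (simp add: pos_semidef_def)
  moreover have "S' $ i $ j = 0" if "\<not> E i j" for i j
    using that S(1) simple_graph_sym[OF E, of j i] by (auto simp: S'_def transpose_def)
  ultimately show thesis using that by blast
qed

lemma simple_complement_graph: "simple_graph E \<Longrightarrow> simple_graph (complement_graph E)"
  by (auto simp: simple_graph_def complement_graph_def symp_def irreflp_def)

text \<open>
  Both estimates for the matrix \<open>t I + S\<close> use a dual certificate \<open>t I - J + S\<close> for some \<open>t\<close> above the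
  theta number: adding \<open>J\<close> keeps it positive semidefinite, and pairing it with \<open>J\<close> bounds the sum of
  entries from below.
\<close>
lemma card_le_theta_mult_theta_complement:
  fixes E :: "'v::finite \<Rightarrow> 'v \<Rightarrow> bool"
  assumes E: "simple_graph E"
  shows "real CARD('v) \<le> lovasz_theta E * lovasz_theta (complement_graph E)"
proof -
  let ?n = "real CARD('v)" and ?c = "lovasz_theta (complement_graph E)"
  have c: "1 \<le> ?c" by (intro lovasz_theta_bounds simple_complement_graph E)
  have "?n / ?c \<le> t" if t: "lovasz_theta E < t" for t
  proof -
    obtain S where S: "\<And>i j. \<not> E i j \<Longrightarrow> S $ i $ j = 0"
      "pos_semidef (t *\<^sub>R mat 1 - all_ones + S)"
      using theta_dual_feasible[OF E t] by blast
    let ?Y = "t *\<^sub>R mat 1 + S"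
    have "pos_semidef ((t *\<^sub>R mat 1 - all_ones + S) + outer 1)"
      by (intro pos_semidef_add S(2) pos_semidef_outer)
    then have psd: "pos_semidef ?Y"
      by (simp add: all_ones_eq_outer algebra_simps)
    have "0 \<le> outer 1 \<bullet> (t *\<^sub>R mat 1 - all_ones + S)"
      by (intro pos_semidef_inner_nonneg pos_semidef_outer S(2))
    then have "?n\<^sup>2 \<le> all_ones \<bullet> ?Y"
      using inner_all_ones_all_ones[where ?'v='v]
      by (simp add: inner_add_right inner_diff_right flip: all_ones_eq_outer)
    also have "\<dots> \<le> ?c * (mat 1 \<bullet> ?Y)"
      using S(1) by (intro inner_all_ones_le_theta simple_complement_graph E psd)
        (simp add: complement_graph_def mat_def)
    also have "mat 1 \<bullet> ?Y = ?n * t"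
      using S(1) E unfolding inner_mat_1 by (simp add: simple_graph_def irreflp_def mat_def)
    finally have "?n \<le> ?c * t"
      by (simp add: power2_eq_square mult.left_commute)
    then show ?thesis using c by (simp add: pos_divide_le_eq mult.commute)
  qed
  then have "?n / ?c \<le> lovasz_theta E" by (rule dense_ge)
  then show ?thesis using c by (simp add: pos_divide_le_eq)
qed

section \<open>Comparing \<open>mu\<close> with the theta numbers\<close>

text \<open>
  Conjugating \<open>W\<close> by the diagonal matrix of \<open>v\<close> keeps it positive semidefinite and zero on the edges.
  The result has trace \<open>d * (v \<bullet> v)\<close> and its entries sum to the value of the form of \<open>W\<close> at \<open>v\<close>.
\<close>
lemma quadratic_form_le_theta:
  fixes E :: "'v::finite \<Rightarrow> 'v \<Rightarrow> bool"
  assumes E: "simple_graph E" and W: "pos_semidef W" and zero: "\<And>i j. E i j \<Longrightarrow> W $ i $ j = 0"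
    and diag: "\<And>i. W $ i $ i = d"
  shows "v \<bullet> (W *v v) \<le> lovasz_theta E * d * (v \<bullet> v)"
proof -
  define D where "D = schur_product (outer v) W"
  have "w \<bullet> (D *v w) = (\<chi> i. v $ i * w $ i) \<bullet> (W *v (\<chi> i. v $ i * w $ i))" for w
    unfolding quadratic_form D_def schur_product_def outer_def by (simp add: mult_ac)
  then have "pos_semidef D"
    using W pos_semidef_entry_commute[OF W]
    by (simp add: pos_semidef_def) (simp add: D_def schur_product_def outer_def transpose_def vec_eq_iff mult_ac)
  then have "all_ones \<bullet> D \<le> lovasz_theta E * (mat 1 \<bullet> D)"
    using zero by (intro inner_all_ones_le_theta E) (simp_all add: D_def schur_product_def)
  moreover have "all_ones \<bullet> D = v \<bullet> (W *v v)"
    unfolding quadratic_form inner_matrix D_def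
    by (simp add: all_ones_def schur_product_def outer_def mult_ac)
  moreover have "mat 1 \<bullet> D = d * (v \<bullet> v)"
    unfolding inner_mat_1
    by (simp add: D_def schur_product_def outer_def diag inner_vec_def sum_distrib_left mult_ac)
  ultimately show ?thesis by (simp add: mult.assoc)
qed

lemma mu_le_card_div_theta:
  fixes E :: "'v::finite \<Rightarrow> 'v \<Rightarrow> bool"
  assumes E: "simple_graph E" and W: "pos_semidef W" and zero: "\<And>i j. E i j \<Longrightarrow> W $ i $ j = 0"
    and diag: "\<And>i. W $ i $ i = 1 / real CARD('v)" and opt: "all_ones \<bullet> W = lovasz_theta E"
  shows "mu E \<le> real CARD('v) / lovasz_theta E"
proof -
  let ?n = "real CARD('v)" and ?c = "lovasz_theta E"
  have c: "1 \<le> ?c" "?c \<le> ?n" by (rule lovasz_theta_bounds[OF E])+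
  then have k: "1 \<le> ?n / ?c" "?n / ?c \<le> ?n" by (simp_all add: field_simps)
  let ?X = "(?n / ?c) *\<^sub>R W"
  have X: "pos_semidef ?X" using c by (intro pos_semidef_scaleR W) simp
  have "v \<bullet> (?X *v v) \<le> v \<bullet> v" for v
    using quadratic_form_le_theta[OF E W zero diag, of v] c
    by (simp add: scaleR_matrix_vector_assoc[symmetric] field_simps)
  then have "loewner_le ?X (mat 1)"
    using X by (simp add: loewner_le_mat_1 pos_semidef_def)
  then have "?X \<in> theta_feasible E (?n / ?c)"
    using X zero by (simp add: theta_feasible_iff loewner_le_def inner_mat_1 diag)
  moreover have "all_ones \<bullet> ?X = ?n" using opt c by simp
  ultimately have "?n \<le> theta_k E (?n / ?c)"
    using theta_k_max(2)[OF E k] by (metis trace_inner_all_ones_eq_inner)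
  moreover have "theta_k E (?n / ?c) \<le> ?n"
  proof -
    obtain Z where Z: "Z \<in> theta_feasible E (?n / ?c)" "theta_k E (?n / ?c) = all_ones \<bullet> Z"
      using theta_k_max(1)[OF E k] by (auto simp: trace_inner_all_ones_eq_inner)
    then have "0 \<le> outer 1 \<bullet> (mat 1 - Z)"
      by (intro pos_semidef_inner_nonneg pos_semidef_outer) (simp add: theta_feasible_iff)
    then show ?thesis
      by (simp add: Z(2) inner_diff_right inner_commute[of _ "mat 1"] inner_mat_1
          flip: all_ones_eq_outer) (simp add: all_ones_def)
  qed
  ultimately show ?thesis using k by (intro mu_min(3)[OF E]) auto
qed

text \<open>
  \<open>J / n\<close> projects onto the span of the all-ones vector, an eigenvector of \<open>Y\<close> with eigenvalue 1.
  So the form of the difference at \<open>v\<close> is the form of \<open>Y\<close> at the vector \<open>v\<close> with its mean subtracted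
  from every entry.
\<close>
lemma pos_semidef_minus_all_ones:
  fixes Y :: "real^'v::finite^'v"
  assumes Y: "pos_semidef Y" and fix_one: "Y *v 1 = 1"
  shows "pos_semidef (Y - (1 / real CARD('v)) *\<^sub>R all_ones)"
proof -
  let ?n = "real CARD('v)"
  have sym: "transpose Y = Y" using Y by (simp add: pos_semidef_def)
  have "v \<bullet> ((Y - (1 / ?n) *\<^sub>R all_ones) *v v) =
     (v + (- (1 \<bullet> v) / ?n) *\<^sub>R 1) \<bullet> (Y *v (v + (- (1 \<bullet> v) / ?n) *\<^sub>R 1))" for v
  proof -
    have "1 \<bullet> (Y *v v) = 1 \<bullet> v"
      using inner_matrix_vector_commute[OF sym, of 1 v] by (simp add: fix_one inner_commute)
    then have "(v + (- (1 \<bullet> v) / ?n) *\<^sub>R 1) \<bullet> (Y *v (v + (- (1 \<bullet> v) / ?n) *\<^sub>R 1))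
        = v \<bullet> (Y *v v) - (1 \<bullet> v)\<^sup>2 / ?n"
      unfolding quadratic_form_add_scaleR[OF sym]
      by (simp add: fix_one inner_one_one power2_eq_square field_simps)
    moreover have "v \<bullet> (all_ones *v v) = (1 \<bullet> v)\<^sup>2"
      by (simp add: all_ones_eq_outer quadratic_form_outer)
    ultimately show ?thesis
      by (simp add: matrix_vector_mult_diff_rdistrib inner_diff_right
          scaleR_matrix_vector_assoc[symmetric])
  qed
  moreover have "transpose (Y - (1 / ?n) *\<^sub>R all_ones) = Y - (1 / ?n) *\<^sub>R all_ones"
    using pos_semidef_entry_commute[OF Y] by (simp add: transpose_def all_ones_def vec_eq_iff)
  ultimately show ?thesis
    using pos_semidef_nonneg[OF Y] by (simp add: pos_semidef_def)
qed

text \<open>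
  Weak duality. A feasible matrix \<open>W\<close> for the complement and \<open>Y\<close> have disjoint supports off the
  diagonal, so their pairing only sees the two diagonals.
\<close>
lemma theta_complement_le:
  fixes E :: "'v::finite \<Rightarrow> 'v \<Rightarrow> bool"
  assumes E: "simple_graph E" and Y: "pos_semidef Y" and zero: "\<And>i j. E i j \<Longrightarrow> Y $ i $ j = 0"
    and diag: "\<And>i. Y $ i $ i = k / real CARD('v)" and fix_one: "Y *v 1 = 1"
  shows "lovasz_theta (complement_graph E) \<le> k"
proof -
  let ?n = "real CARD('v)"
  obtain W where W: "pos_semidef W" "\<And>i j. complement_graph E i j \<Longrightarrow> W $ i $ j = 0"
    "mat 1 \<bullet> W = 1" "all_ones \<bullet> W = lovasz_theta (complement_graph E)"
    using lovasz_theta_attained[OF simple_complement_graph[OF E]] by blast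
  have "W $ i $ j * Y $ i $ j = (if i = j then W $ i $ i * (k / ?n) else 0)" for i j
    using zero[of i j] W(2)[of i j] by (auto simp: diag complement_graph_def)
  then have "W \<bullet> Y = (\<Sum>i\<in>UNIV. W $ i $ i * (k / ?n))"
    by (simp add: inner_matrix)
  also have "\<dots> = k / ?n"
    using W(3) unfolding inner_mat_1 sum_distrib_right[symmetric] by simp
  finally have "W \<bullet> Y = k / ?n" .
  moreover have "0 \<le> W \<bullet> (Y - (1 / ?n) *\<^sub>R all_ones)"
    by (intro pos_semidef_inner_nonneg pos_semidef_minus_all_ones W Y fix_one)
  ultimately show ?thesis
    by (simp add: inner_diff_right inner_commute[of W all_ones] W(4) divide_le_cancel)
qed

lemma homogeneous_diag:
  fixes Y :: "real^'v::finite^'v"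
  assumes "homogeneous \<A>" "Y \<in> \<A>"
  shows "Y $ i $ i = (mat 1 \<bullet> Y) / real CARD('v)"
proof -
  have "(\<Sum>j\<in>UNIV. Y $ j $ j) = (\<Sum>j\<in>(UNIV :: 'v set). Y $ i $ i)"
    using assms unfolding homogeneous_def by (intro sum.cong refl) blast
  then show ?thesis by (simp add: inner_mat_1)
qed

text \<open>
  The row sums of \<open>Y\<close> form the diagonal of \<open>Y J\<close>, which lies in the algebra.
\<close>
lemma homogeneous_row_sums:
  fixes Y :: "real^'v::finite^'v"
  assumes hom: "homogeneous \<A>" and A: "partially_coherent_algebra E \<A>" and Y: "Y \<in> \<A>"
  shows "Y *v 1 = ((all_ones \<bullet> Y) / real CARD('v)) *\<^sub>R 1"
proof -
  let ?n = "real CARD('v)"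
  have "Y ** all_ones \<in> \<A>"
    using A Y by (simp add: partially_coherent_algebra_def matrix_subalgebra_def)
  then have "(Y ** all_ones) $ i $ i = (mat 1 \<bullet> (Y ** all_ones)) / ?n" for i
    by (rule homogeneous_diag[OF hom])
  moreover have "mat 1 \<bullet> (Y ** all_ones) = all_ones \<bullet> Y"
    unfolding inner_mat_1 unfolding inner_matrix
    by (simp add: matrix_matrix_mult_def all_ones_def)
  moreover have "(Y ** all_ones) $ i $ i = (Y *v 1) $ i" for i
    by (simp add: matrix_matrix_mult_def matrix_vector_mult_def all_ones_def)
  ultimately show ?thesis by (simp add: vec_eq_iff)
qed

theorem corollary7:
  fixes E :: "'v::finite \<Rightarrow> 'v \<Rightarrow> bool"
  assumes "simple_graph E"
    and "\<exists>\<A>. partially_coherent_algebra E \<A> \<and> homogeneous \<A>"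
  shows "mu E = lovasz_theta (complement_graph E)"
proof (rule antisym)
  note E = assms(1)
  let ?n = "real CARD('v)"
  obtain \<A> where A: "partially_coherent_algebra E \<A>" and hom: "homogeneous \<A>"
    using assms(2) by blast
  show "mu E \<le> lovasz_theta (complement_graph E)"
  proof -
    obtain W where W: "pos_semidef W" "\<And>i j. E i j \<Longrightarrow> W $ i $ j = 0" "mat 1 \<bullet> W = 1"
      "all_ones \<bullet> W = lovasz_theta E"
      using lovasz_theta_attained[OF E] by blast
    obtain V where V: "V \<in> \<A>" "pos_semidef V" "\<And>i j. E i j \<Longrightarrow> V $ i $ j = 0"
      "mat 1 \<bullet> V = 1" "all_ones \<bullet> V = lovasz_theta E"
      using algebra_projection[OF A W(1)] W(2-4) unfolding schur_product_adjacency_eq_0 by metis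
    have "mu E \<le> ?n / lovasz_theta E"
      using V homogeneous_diag[OF hom V(1)] by (intro mu_le_card_div_theta[OF E V(2)]) auto
    also have "\<dots> \<le> lovasz_theta (complement_graph E)"
      using card_le_theta_mult_theta_complement[OF E] lovasz_theta_bounds(1)[OF E]
      by (simp add: pos_divide_le_eq mult.commute)
    finally show ?thesis .
  qed
  show "lovasz_theta (complement_graph E) \<le> mu E"
  proof -
    have "1 \<le> mu E" "mu E \<le> ?n" using mu_min(1)[OF E] by auto
    then obtain X where "X \<in> theta_feasible E (mu E)" "all_ones \<bullet> X = ?n"
      using theta_k_max(1)[OF E, of "mu E"] mu_min(2)[OF E]
      by (auto simp: trace_inner_all_ones_eq_inner)
    then have X: "pos_semidef X" "\<forall>i j. E i j \<longrightarrow> X $ i $ j = 0" "mat 1 \<bullet> X = mu E"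
      "all_ones \<bullet> X = ?n"
      by (auto simp: theta_feasible_iff)
    obtain Y where Y: "Y \<in> \<A>" "pos_semidef Y" "\<And>i j. E i j \<Longrightarrow> Y $ i $ j = 0"
      "mat 1 \<bullet> Y = mu E" "all_ones \<bullet> Y = ?n"
      using algebra_projection[OF A X(1)] X(2-4) unfolding schur_product_adjacency_eq_0 by metis
    show ?thesis
      using Y homogeneous_diag[OF hom Y(1)] homogeneous_row_sums[OF hom A Y(1)]
      by (intro theta_complement_le[OF E Y(2)]) auto
  qed
qed

end
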